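(* Let $U:=\langle s_{01},s_{02},s_{03}+s_{12}\rangle\le\Lambda$. The stabilizer of $U$ in $\mathrm{GL}_4(\mathbb K)$ is $$\mathrm{GL}_4(\mathbb K)_U=\left\{\begin{pmatrix}a&b'&c\\0&D&e\\0&0&\frac1a\det D\end{pmatrix}\ \middle|\ a,c\in\mathbb K,\ a\ne0,\ b,e\in\mathbb K^2,\ D\in\mathrm{GL}_2(\mathbb K)\right\}.$$ Its orbits on $\mathbb K^4$ are represented by $0$, $b_0$, $b_1$, $b_3$, and its orbits on $\Lambda/U$ are represented by $U$, $s_{03}+U$, $s_{13}+U$.
   Context: $\mathbb K$ is an arbitrary field; $X'$ denotes the transpose of a matrix $X$; $b_0,b_1,b_2,b_3$ is the standard basis of $\mathbb K^4$ (column vectors). $\Lambda=\mathbb K^4\wedge\mathbb K^4$ is the space of skew-symmetric $4\times4$ matrices over $\mathbb K$ with zero diagonal, and $s_{jk}:=b_jb_k'-b_kb_j'$ for $0\le j<k\le3$. The group $\mathrm{GL}_4(\mathbb K)$ acts on $\mathbb K^4$ naturally and on $\Lambda$ by $M.X:=MXM'$. For $U\le\Lambda$, $\mathrm{GL}_4(\mathbb K)_U$ is the stabilizer of $U$ under this action; it acts on $\Lambda/U$. $\langle\cdots\rangle$ denotes $\mathbb K$-span. (The space $U$ is denoted $E+T$ in the paper.) "The orbits are represented by" a list means that each orbit contains exactly one member of the list. *)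

theory Defs
  imports "HOL-Analysis.Analysis" "HOL-Algebra.Group_Action" "HOL-Library.Set_Algebras"
begin

text \<open>
  The index type \<open>4\<close> has exactly the elements \<open>0, 1, 2, 3\<close>, so indices agree with
  \<open>b\<^sub>0, \<dots>, b\<^sub>3\<close>. In the index type \<open>2\<close>, used for the middle block and for vectors of length two,
  the first coordinate is \<open>1\<close> and the second is \<open>2\<close> (with \<open>2 = 0\<close>), the library's convention.
\<close>

abbreviation basis_vec :: "4 \<Rightarrow> 'a::field ^ 4" where
  "basis_vec j \<equiv> axis j 1"

definition Lam :: "('a::field ^ 4 ^ 4) set" where
  "Lam = {X. transpose X = - X \<and> (\<forall>i. X $ i $ i = 0)}"

definition s :: "4 \<Rightarrow> 4 \<Rightarrow> 'a::field ^ 4 ^ 4" where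
  "s j k =
     (columnvector (basis_vec j) :: 'a ^ 1 ^ 4) ** rowvector (basis_vec k)
     - (columnvector (basis_vec k) :: 'a ^ 1 ^ 4) ** rowvector (basis_vec j)"

definition mat_scale :: "'a::field \<Rightarrow> 'a ^ 'n ^ 'm \<Rightarrow> 'a ^ 'n ^ 'm" where
  "mat_scale c X = (\<chi> i j. c * X $ i $ j)"

global_interpretation mat_vs: vector_space mat_scale
proof
  fix a b :: 'a and X Y :: "'a ^ 'n ^ 'm"
  show "mat_scale a (X + Y) = mat_scale a X + mat_scale a Y"
    by (simp add: mat_scale_def vec_eq_iff distrib_left)
  show "mat_scale (a + b) X = mat_scale a X + mat_scale b X"
    by (simp add: mat_scale_def vec_eq_iff distrib_right)
  show "mat_scale a (mat_scale b X) = mat_scale (a * b) X"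
    by (simp add: mat_scale_def vec_eq_iff mult.assoc)
  show "mat_scale 1 X = X"
    by (simp add: mat_scale_def vec_eq_iff)
qed

definition U :: "('a::field ^ 4 ^ 4) set" where
  "U = mat_vs.span {s 0 1, s 0 2, s 0 3 + s 1 2}"

definition Lam_mod_U :: "('a::field ^ 4 ^ 4) set set" where
  "Lam_mod_U = {X +o U | X. X \<in> Lam}"

definition GL :: "('a::field ^ 'n ^ 'n) monoid" where
  "GL = \<lparr>carrier = {M. invertible M}, mult = (\<lambda>M N. M ** N), one = mat 1\<rparr>"

definition act :: "'a::field ^ 4 ^ 4 \<Rightarrow> 'a ^ 4 ^ 4 \<Rightarrow> 'a ^ 4 ^ 4" where
  "act M X = M ** X ** transpose M"

text \<open>
  The induced action on sets of matrices. It serves both for the stabilizer of \<open>U\<close> and for the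
  action on \<open>\<Lambda>/U\<close>, whose elements are cosets \<open>X + U\<close>; see \<open>set_act_coset\<close>.
\<close>
definition set_act :: "'a::field ^ 4 ^ 4 \<Rightarrow> ('a ^ 4 ^ 4) set \<Rightarrow> ('a ^ 4 ^ 4) set" where
  "set_act M A = act M ` A"

definition GL_U :: "('a::field ^ 4 ^ 4) monoid" where
  "GL_U = GL\<lparr>carrier := stabilizer GL set_act U\<rparr>"

text \<open>
  Uniqueness refers to positions in the list, so a list with repetitions never qualifies
  (every entry lies in some orbit).
\<close>
definition represent_orbits ::
  "('g, 'm) monoid_scheme \<Rightarrow> 'x set \<Rightarrow> ('g \<Rightarrow> 'x \<Rightarrow> 'x) \<Rightarrow> 'x list \<Rightarrow> bool" where
  "represent_orbits G E \<phi> xs \<longleftrightarrow>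
     set xs \<subseteq> E \<and> (\<forall>Q \<in> orbits G E \<phi>. \<exists>!i. i < length xs \<and> xs ! i \<in> Q)"

definition vec4 :: "'b \<Rightarrow> 'b \<Rightarrow> 'b \<Rightarrow> 'b \<Rightarrow> 'b ^ 4" where
  "vec4 x0 x1 x2 x3 = (\<chi> i. if i = 0 then x0 else if i = 1 then x1 else if i = 2 then x2 else x3)"

definition block_mat ::
  "'a::field \<Rightarrow> 'a ^ 2 \<Rightarrow> 'a \<Rightarrow> 'a ^ 2 ^ 2 \<Rightarrow> 'a ^ 2 \<Rightarrow> 'a ^ 4 ^ 4" where
  "block_mat a b c D e = vec4
     (vec4 a (b $ 1)     (b $ 2)     c)
     (vec4 0 (D $ 1 $ 1) (D $ 1 $ 2) (e $ 1))
     (vec4 0 (D $ 2 $ 1) (D $ 2 $ 2) (e $ 2))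
     (vec4 0 0           0           ((1 / a) * det D))"

lemma subspace_Lam: "mat_vs.subspace Lam"
proof -
  have "transpose (X + Y) = transpose X + transpose Y"
    and "transpose (mat_scale c X) = mat_scale c (transpose X)"
    and "mat_scale c (- X) = - mat_scale c X" and "transpose 0 = (0 :: 'a ^ 4 ^ 4)"
    for X Y :: "'a ^ 4 ^ 4" and c
    by (simp_all add: transpose_def mat_scale_def vec_eq_iff)
  then show ?thesis
    by (simp add: mat_vs.subspace_def Lam_def) (simp add: mat_scale_def)
qed

lemma s_nth: "s j k $ p $ q =
    axis j 1 $ p * axis k 1 $ q - axis k 1 $ p * axis j 1 $ q"
  unfolding s_def by (simp add: matrix_matrix_mult_def columnvector_def rowvector_def)

lemma s_in_Lam: "s j k \<in> Lam"
  unfolding Lam_def vec_eq_iff transpose_def by (simp add: s_nth)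

lemma U_subset_Lam: "U \<subseteq> Lam"
  unfolding U_def
proof (rule mat_vs.span_minimal)
  have "s 0 3 + s 1 2 \<in> Lam"
    by (rule mat_vs.subspace_add[OF subspace_Lam s_in_Lam s_in_Lam])
  then show "{s 0 1, s 0 2, s 0 3 + s 1 2} \<subseteq> Lam"
    using s_in_Lam by blast
qed (rule subspace_Lam)

lemma act_add: "act M (X + Y) = act M X + act M Y"
proof -
  have "(A + B) ** C = A ** C + B ** C" for A B C :: "'a ^ 4 ^ 4"
    by (simp add: matrix_matrix_mult_def vec_eq_iff distrib_right sum.distrib)
  then show ?thesis
    by (simp add: act_def matrix_add_ldistrib)
qed

lemma set_act_coset:
  assumes "M \<in> carrier GL_U"
  shows "set_act M (X +o U) = act M X +o U"
proof -
  have U: "act M ` U = U"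
    using assms by (simp add: GL_U_def stabilizer_def set_act_def)
  have coset: "Y +o A = (\<lambda>B. Y + B) ` A" for Y :: "'a ^ 4 ^ 4" and A
    by (auto simp: elt_set_plus_def)
  have "act M ` (X +o U) = act M X +o (act M ` U)"
    by (simp add: coset image_image act_add)
  then show ?thesis
    by (simp add: set_act_def U)
qed

end

theory Submission
  imports Defs
begin

text \<open>
  The entries of \<open>M X M'\<close> for \<open>X \<in> \<Lambda>\<close> are combinations of the \<open>2 \<times> 2\<close> minors of \<open>M\<close>. If \<open>M\<close> stabilizes
  \<open>U\<close>, then the bivectors \<open>m\<^sub>0 \<and> m\<^sub>1\<close> and \<open>m\<^sub>0 \<and> m\<^sub>2\<close> of columns are independent elements of \<open>U\<close> of rank
  two, hence lie in \<open>\<langle>s\<^sub>0\<^sub>1, s\<^sub>0\<^sub>2\<rangle>\<close>. This forces \<open>m\<^sub>0 \<in> \<langle>b\<^sub>0\<rangle>\<close> and \<open>m\<^sub>1, m\<^sub>2 \<in> \<langle>b\<^sub>0, b\<^sub>1, b\<^sub>2\<rangle>\<close>; the image of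
  \<open>s\<^sub>0\<^sub>3 + s\<^sub>1\<^sub>2\<close> then gives the last diagonal entry. Orbits are separated by the invariant flags
  of \<open>K\<^sup>4\<close> and \<open>\<Lambda>/U\<close>.
\<close>

section \<open>Coordinates on \<open>Lam\<close> and equations for \<open>U\<close>\<close>

lemma UNIV_4_from_0: "(UNIV :: 4 set) = {0, 1, 2, 3}"
  unfolding UNIV_4 by auto

lemma all_4_iff: "(\<forall>i::4. P i) \<longleftrightarrow> P 0 \<and> P 1 \<and> P 2 \<and> P 3"
proof -
  \<comment> \<open>\<open>forall_4\<close> runs over 1, 2, 3, 4; reading 4 as 0 gives the indices
    of the standard basis.\<close>
  have "(4 :: 4) = 0" by simp
  then show ?thesis unfolding forall_4 by metis
qed

lemma sum_UNIV_4: "sum f (UNIV :: 4 set) = f 0 + f 1 + f 2 + f 3"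
  for f :: "4 \<Rightarrow> 'a::comm_monoid_add"
  unfolding UNIV_4_from_0 by (simp add: add.assoc)

lemma vec4_nth [simp]:
  "vec4 x0 x1 x2 x3 $ 0 = x0" "vec4 x0 x1 x2 x3 $ 1 = x1"
  "vec4 x0 x1 x2 x3 $ 2 = x2" "vec4 x0 x1 x2 x3 $ 3 = x3"
  by (simp_all add: vec4_def)

lemma LamD:
  assumes "X \<in> Lam"
  shows "X $ i $ i = 0" "X $ 1 $ 0 = - X $ 0 $ 1" "X $ 2 $ 0 = - X $ 0 $ 2" "X $ 3 $ 0 = - X $ 0 $ 3"
    "X $ 2 $ 1 = - X $ 1 $ 2" "X $ 3 $ 1 = - X $ 1 $ 3" "X $ 3 $ 2 = - X $ 2 $ 3"
proof -
  have "X $ i $ j = transpose X $ j $ i" for i j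
    by (simp add: transpose_def)
  moreover have "transpose X = - X"
    using assms by (simp only: Lam_def mem_Collect_eq)
  ultimately have *: "X $ i $ j = - X $ j $ i" for i j
    by (metis vector_uminus_component)
  show "X $ i $ i = 0" using assms by (simp add: Lam_def)
  show "X $ 1 $ 0 = - X $ 0 $ 1" "X $ 2 $ 0 = - X $ 0 $ 2" "X $ 3 $ 0 = - X $ 0 $ 3"
    "X $ 2 $ 1 = - X $ 1 $ 2" "X $ 3 $ 1 = - X $ 1 $ 3" "X $ 3 $ 2 = - X $ 2 $ 3"
    by (rule *)+
qed

lemma Lam_eqI:
  assumes "X \<in> Lam" "Y \<in> Lam"
    and "X $ 0 $ 1 = Y $ 0 $ 1" "X $ 0 $ 2 = Y $ 0 $ 2" "X $ 0 $ 3 = Y $ 0 $ 3"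
    and "X $ 1 $ 2 = Y $ 1 $ 2" "X $ 1 $ 3 = Y $ 1 $ 3" "X $ 2 $ 3 = Y $ 2 $ 3"
  shows "X = Y"
  unfolding vec_eq_iff all_4_iff using assms(3-) by (simp add: LamD[OF assms(1)] LamD[OF assms(2)])

definition lam_mat :: "'a::field \<Rightarrow> 'a \<Rightarrow> 'a \<Rightarrow> 'a \<Rightarrow> 'a \<Rightarrow> 'a \<Rightarrow> 'a ^ 4 ^ 4" where
  "lam_mat x01 x02 x03 x12 x13 x23 = vec4
     (vec4 0 x01 x02 x03)
     (vec4 (- x01) 0 x12 x13)
     (vec4 (- x02) (- x12) 0 x23)
     (vec4 (- x03) (- x13) (- x23) 0)"

lemma lam_mat_in_Lam: "lam_mat x01 x02 x03 x12 x13 x23 \<in> Lam"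
  unfolding Lam_def transpose_def vec_eq_iff mem_Collect_eq all_4_iff by (simp add: lam_mat_def)

lemma lam_mat_nth [simp]:
  "lam_mat x01 x02 x03 x12 x13 x23 $ 0 $ 1 = x01"
  "lam_mat x01 x02 x03 x12 x13 x23 $ 0 $ 2 = x02"
  "lam_mat x01 x02 x03 x12 x13 x23 $ 0 $ 3 = x03"
  "lam_mat x01 x02 x03 x12 x13 x23 $ 1 $ 2 = x12"
  "lam_mat x01 x02 x03 x12 x13 x23 $ 1 $ 3 = x13"
  "lam_mat x01 x02 x03 x12 x13 x23 $ 2 $ 3 = x23"
  by (simp_all add: lam_mat_def)

lemma s_nth_iff:
  "s j k $ p $ q = (if p = j \<and> q = k then 1 else 0) - (if p = k \<and> q = j then 1 else (0::'a::field))"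
proof -
  have "(if P then 1 else 0) * (if Q then 1 else 0) = (if P \<and> Q then 1 else (0::'a))" for P Q
    by simp
  then show ?thesis
    by (simp only: s_nth axis_def vec_lambda_beta)
qed

text \<open>The three generators satisfy these linear equations, hence so does their span.
  Conversely, the entries (0,1), (0,2) and (0,3) of a solution are its coefficients with respect to
  the generators.\<close>

lemma U_iff:
  "X \<in> U \<longleftrightarrow> X \<in> Lam \<and> X $ 0 $ 3 = X $ 1 $ 2 \<and> X $ 1 $ 3 = 0 \<and> X $ 2 $ 3 = (0::'a::field)"
proof
  let ?S = "{X :: 'a ^ 4 ^ 4. X \<in> Lam \<and> X $ 0 $ 3 = X $ 1 $ 2 \<and> X $ 1 $ 3 = 0 \<and> X $ 2 $ 3 = 0}"
  have "mat_vs.subspace ?S"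
    using subspace_Lam unfolding mat_vs.subspace_def by (auto simp: mat_scale_def)
  moreover have "{s 0 1, s 0 2, s 0 3 + s 1 2} \<subseteq> ?S"
    by (auto simp: s_in_Lam mat_vs.subspace_add[OF subspace_Lam] s_nth_iff)
  ultimately have "U \<subseteq> ?S"
    unfolding U_def by (rule mat_vs.span_minimal[rotated])
  then show "X \<in> Lam \<and> X $ 0 $ 3 = X $ 1 $ 2 \<and> X $ 1 $ 3 = 0 \<and> X $ 2 $ 3 = 0" if "X \<in> U"
    using that by blast
next
  assume X: "X \<in> Lam \<and> X $ 0 $ 3 = X $ 1 $ 2 \<and> X $ 1 $ 3 = 0 \<and> X $ 2 $ 3 = 0"
  define Y where "Y = mat_scale (X $ 0 $ 1) (s 0 1) + mat_scale (X $ 0 $ 2) (s 0 2)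
    + mat_scale (X $ 0 $ 3) (s 0 3 + s 1 2)"
  have "Y \<in> U"
    unfolding Y_def U_def by (intro mat_vs.span_add mat_vs.span_scale mat_vs.span_base) auto
  moreover have "X = Y"
  proof (rule Lam_eqI)
    show "Y \<in> Lam" using \<open>Y \<in> U\<close> U_subset_Lam by blast
  qed (use X in \<open>simp_all add: Y_def mat_scale_def s_nth_iff\<close>)
  ultimately show "X \<in> U" by simp
qed

section \<open>The action in coordinates\<close>

lemma act_in_Lam:
  assumes "X \<in> Lam"
  shows "act M X \<in> Lam"
  unfolding Lam_def transpose_def vec_eq_iff mem_Collect_eq act_def matrix_matrix_mult_def
  by (simp add: sum_UNIV_4 LamD[OF assms] algebra_simps)

text \<open>\<open>X\<close> is the sum of the \<open>X $ j $ k\<close> times \<open>s j k\<close>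
  over j < k, and \<open>M\<close> sends \<open>s j k\<close> to the wedge product of its columns j
  and k. The factors are therefore the minors of rows p and q.\<close>

lemma act_nth:
  assumes "X \<in> Lam"
  shows "act M X $ p $ q =
      X $ 0 $ 1 * (M $ p $ 0 * M $ q $ 1 - M $ p $ 1 * M $ q $ 0)
    + X $ 0 $ 2 * (M $ p $ 0 * M $ q $ 2 - M $ p $ 2 * M $ q $ 0)
    + X $ 0 $ 3 * (M $ p $ 0 * M $ q $ 3 - M $ p $ 3 * M $ q $ 0)
    + X $ 1 $ 2 * (M $ p $ 1 * M $ q $ 2 - M $ p $ 2 * M $ q $ 1)
    + X $ 1 $ 3 * (M $ p $ 1 * M $ q $ 3 - M $ p $ 3 * M $ q $ 1)
    + X $ 2 $ 3 * (M $ p $ 2 * M $ q $ 3 - M $ p $ 3 * M $ q $ 2)"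
  unfolding act_def matrix_matrix_mult_def transpose_def
  by (simp add: sum_UNIV_4 LamD[OF assms] algebra_simps)

lemma matrix_vector_mult_nth_4:
  "(M *v v) $ i = M $ i $ 0 * v $ 0 + M $ i $ 1 * v $ 1 + M $ i $ 2 * v $ 2 + M $ i $ 3 * v $ 3"
  for M :: "'a::comm_semiring_1 ^ 4 ^ 'n"
  by (simp add: matrix_vector_mult_def sum_UNIV_4)

section \<open>Block matrices stabilize \<open>U\<close>\<close>

lemma invertible_iff_ker:
  "invertible M \<longleftrightarrow> (\<forall>x. M *v x = 0 \<longrightarrow> x = 0)" for M :: "'a::field ^ 'n ^ 'n"
  unfolding invertible_left_inverse matrix_left_invertible_ker ..

lemma block_mat_nth [simp]:
  "block_mat a b c D e $ 0 = vec4 a (b $ 1) (b $ 2) c"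
  "block_mat a b c D e $ 1 = vec4 0 (D $ 1 $ 1) (D $ 1 $ 2) (e $ 1)"
  "block_mat a b c D e $ 2 = vec4 0 (D $ 2 $ 1) (D $ 2 $ 2) (e $ 2)"
  "block_mat a b c D e $ 3 = vec4 0 0 0 (det D / a)"
  by (simp_all add: block_mat_def)

text \<open>A kernel vector vanishes by back substitution: first coordinate 3, then coordinates 1
  and 2 by Cramer's rule for \<open>D\<close>, finally coordinate 0.\<close>

lemma invertible_block_mat:
  assumes "a \<noteq> 0" "det D \<noteq> 0"
  shows "invertible (block_mat a b c D e)"
  unfolding invertible_iff_ker
proof (intro allI impI)
  fix x :: "'a ^ 4"
  assume "block_mat a b c D e *v x = 0"
  then have x: "(block_mat a b c D e *v x) $ i = 0" for i by simp
  have x3: "x $ 3 = 0"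
    using x[of 3] assms by (simp add: matrix_vector_mult_nth_4)
  have 1: "D $ 1 $ 1 * x $ 1 + D $ 1 $ 2 * x $ 2 = 0" and 2: "D $ 2 $ 1 * x $ 1 + D $ 2 $ 2 * x $ 2 = 0"
    using x[of 1] x[of 2] x3 by (simp_all add: matrix_vector_mult_nth_4)
  have "det D * x $ 1 = D $ 2 $ 2 * (D $ 1 $ 1 * x $ 1 + D $ 1 $ 2 * x $ 2)
      - D $ 1 $ 2 * (D $ 2 $ 1 * x $ 1 + D $ 2 $ 2 * x $ 2)"
    unfolding det_2 by (simp add: algebra_simps)
  moreover have "det D * x $ 2 = D $ 1 $ 1 * (D $ 2 $ 1 * x $ 1 + D $ 2 $ 2 * x $ 2)
      - D $ 2 $ 1 * (D $ 1 $ 1 * x $ 1 + D $ 1 $ 2 * x $ 2)"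
    unfolding det_2 by (simp add: algebra_simps)
  ultimately have "x $ 1 = 0" "x $ 2 = 0"
    using assms 1 2 by auto
  moreover from this have "x $ 0 = 0"
    using x[of 0] x3 assms by (simp add: matrix_vector_mult_nth_4)
  ultimately show "x = 0"
    using x3 unfolding vec_eq_iff all_4_iff by simp
qed

text \<open>On \<open>U\<close> the last diagonal entry \<open>det D / a\<close> makes the entries
  (0,3) and (1,2) both scale by \<open>det D\<close>, so their equality survives. Surjectivity is
  shown by an explicit preimage.\<close>

lemma act_block_mat_U:
  assumes a: "a \<noteq> 0" and D: "det D \<noteq> (0::'a::field)"
  shows "act (block_mat a b c D e) ` U = U"
proof (intro equalityI subsetI)
  fix Y
  assume "Y \<in> act (block_mat a b c D e) ` U"
  then obtain X where X: "X \<in> U" "Y = act (block_mat a b c D e) X" by blast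
  then have "X \<in> Lam" by (simp add: U_iff)
  then show "Y \<in> U"
    using X a unfolding U_iff[of Y] by (simp add: U_iff act_in_Lam act_nth det_2)
next
  fix Y :: "'a ^ 4 ^ 4"
  assume Y: "Y \<in> U"
  let ?M = "block_mat a b c D e"
  \<comment> \<open>Entry (0,3) of the image is \<open>t * det D\<close>, which fixes
    \<open>t\<close>. Entries (0,1) and (0,2) then give a linear system with matrix \<open>a\<close>
    times \<open>D\<close>; dividing its right-hand side by \<open>a * det D\<close> and applying
    the adjugate of \<open>D\<close> solves it.\<close>
  define t where "t = Y $ 0 $ 3 / det D"
  define r1 where "r1 = (Y $ 0 $ 1 - t * (a * e $ 1 + b $ 1 * D $ 1 $ 2 - b $ 2 * D $ 1 $ 1)) / (a * det D)"
  define r2 where "r2 = (Y $ 0 $ 2 - t * (a * e $ 2 + b $ 1 * D $ 2 $ 2 - b $ 2 * D $ 2 $ 1)) / (a * det D)"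
  define X where "X = lam_mat (D $ 2 $ 2 * r1 - D $ 1 $ 2 * r2) (D $ 1 $ 1 * r2 - D $ 2 $ 1 * r1) t t 0 0"
  have XL: "X \<in> Lam" and XU: "X \<in> U" by (simp_all add: X_def lam_mat_in_Lam U_iff)
  have t: "t * det D = Y $ 0 $ 3"
    using D by (simp add: t_def)
  have r1: "a * det D * r1 = Y $ 0 $ 1 - t * (a * e $ 1 + b $ 1 * D $ 1 $ 2 - b $ 2 * D $ 1 $ 1)"
    using a D by (simp add: r1_def)
  have r2: "a * det D * r2 = Y $ 0 $ 2 - t * (a * e $ 2 + b $ 1 * D $ 2 $ 2 - b $ 2 * D $ 2 $ 1)"
    using a D by (simp add: r2_def)
  have "Y = act ?M X"
  proof (rule Lam_eqI)
    show "Y \<in> Lam" using Y by (simp add: U_iff)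
    show "act ?M X \<in> Lam" using XL by (rule act_in_Lam)
    show "Y $ 0 $ 1 = act ?M X $ 0 $ 1"
      using r1 by (simp add: act_nth[OF XL]) (simp add: X_def det_2 algebra_simps)
    show "Y $ 0 $ 2 = act ?M X $ 0 $ 2"
      using r2 by (simp add: act_nth[OF XL]) (simp add: X_def det_2 algebra_simps)
    show "Y $ 0 $ 3 = act ?M X $ 0 $ 3"
      using t a by (simp add: act_nth[OF XL]) (simp add: X_def)
    show "Y $ 1 $ 2 = act ?M X $ 1 $ 2"
      using t Y by (simp add: act_nth[OF XL]) (simp add: X_def U_iff det_2)
    show "Y $ 1 $ 3 = act ?M X $ 1 $ 3" "Y $ 2 $ 3 = act ?M X $ 2 $ 3"
      using Y by (simp_all add: act_nth[OF XL]) (simp_all add: X_def U_iff)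
  qed
  with XU show "Y \<in> act ?M ` U" by blast
qed

section \<open>Stabilizing matrices have block form\<close>

lemma columns_independent:
  fixes M :: "'a::field ^ 4 ^ 4"
  assumes "invertible M"
    and "\<And>i. M $ i $ 0 * x0 + M $ i $ 1 * x1 + M $ i $ 2 * x2 + M $ i $ 3 * x3 = 0"
  shows "x0 = 0" "x1 = 0" "x2 = 0" "x3 = 0"
proof -
  have "M *v vec4 x0 x1 x2 x3 = 0"
    using assms(2) by (simp add: vec_eq_iff matrix_vector_mult_nth_4)
  then have "vec4 x0 x1 x2 x3 = 0"
    using assms(1) by (simp add: invertible_iff_ker)
  then show "x0 = 0" "x1 = 0" "x2 = 0" "x3 = 0"
    unfolding vec_eq_iff all_4_iff by simp_all
qed

lemma stabilizes_U_imp_block_mat: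
  fixes M :: "'a::field ^ 4 ^ 4"
  assumes inv: "invertible M" and sub: "act M ` U \<subseteq> U"
  obtains a b c D e where "a \<noteq> 0" "det D \<noteq> 0" "M = block_mat a b c D e"
proof -
  \<comment> \<open>\<open>m i j k l\<close> is the entry (k,l) of the wedge product of columns i
    and j of \<open>M\<close>.\<close>
  define m where "m i j k l = M $ k $ i * M $ l $ j - M $ k $ j * M $ l $ i" for i j k l
  have gen: "act M (lam_mat x y t t 0 0) \<in> U" for x y t
  proof -
    have "lam_mat x y t t 0 0 \<in> U" by (simp add: U_iff lam_mat_in_Lam)
    then show ?thesis using sub by blast
  qed
  have nth: "act M (lam_mat x y t t 0 0) $ p $ q = x * m 0 1 p q + y * m 0 2 p q + t * (m 0 3 p q + m 1 2 p q)"
    for x y t p q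
    by (simp add: act_nth lam_mat_in_Lam m_def algebra_simps)
  \<comment> \<open>Rank two elements of \<open>U\<close> have vanishing Pfaffian, which on \<open>U\<close> is the square of the entry \<open>(0, 3)\<close>.\<close>
  have m0: "m 0 j 0 3 = 0 \<and> m 0 j 1 2 = 0 \<and> m 0 j 1 3 = 0 \<and> m 0 j 2 3 = 0" if "j = 1 \<or> j = 2" for j
  proof -
    have *: "m 0 j 0 3 = m 0 j 1 2" "m 0 j 1 3 = 0" "m 0 j 2 3 = 0"
      using gen[of 1 0 0] gen[of 0 1 0] that by (auto simp: U_iff nth)
    have "m 0 j 0 3 * m 0 j 1 2 = m 0 j 0 2 * m 0 j 1 3 - m 0 j 0 1 * m 0 j 2 3"
      by (simp add: m_def algebra_simps)
    then show ?thesis using * by simp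
  qed
  have z: "m 0 j k k = 0" "m 0 j k l = - m 0 j l k" for j k l
    by (simp_all add: m_def)
  \<comment> \<open>Laplace expansion of a 3 x 3 minor in which column 0 is repeated.\<close>
  have dep: "M $ k $ 0 * m 0 j p q - M $ p $ 0 * m 0 j k q + M $ q $ 0 * m 0 j k p = 0" for j k p q
    by (simp add: m_def algebra_simps)
  \<comment> \<open>The combination is the wedge of column 0 with x times column 1 plus y times
    column 2, so it is nonzero by independence.\<close>
  have ker: "\<exists>k l. x * m 0 1 k l + y * m 0 2 k l \<noteq> 0" if "x \<noteq> 0 \<or> y \<noteq> 0" for x y
  proof (rule ccontr)
    assume "\<nexists>k l. x * m 0 1 k l + y * m 0 2 k l \<noteq> 0"
    then have *: "x * m 0 1 k l + y * m 0 2 k l = 0" for k l by blast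
    have "\<exists>k. M $ k $ 0 \<noteq> 0"
    proof (rule ccontr)
      assume "\<nexists>k. M $ k $ 0 \<noteq> 0"
      then show False using columns_independent(1)[OF inv, of 1 0 0 0] by simp
    qed
    then obtain k where k: "M $ k $ 0 \<noteq> 0" ..
    \<comment> \<open>Row k of the vanishing bivector, read as a linear relation among the
      columns.\<close>
    have "M $ i $ 0 * - (M $ k $ 1 * x + M $ k $ 2 * y) + M $ i $ 1 * (M $ k $ 0 * x)
        + M $ i $ 2 * (M $ k $ 0 * y) + M $ i $ 3 * 0 = 0" for i
      using *[of k i] by (simp add: m_def algebra_simps)
    from columns_independent(2,3)[OF inv this] k that show False by simp
  qed
  \<comment> \<open>By \<open>m0\<close> both bivectors lie in the span of \<open>s 0 1\<close> and
    \<open>s 0 2\<close>; this is the determinant of their coordinates there.\<close>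
  have nz: "m 0 1 0 1 * m 0 2 0 2 - m 0 1 0 2 * m 0 2 0 1 \<noteq> 0"
  proof
    assume det0: "m 0 1 0 1 * m 0 2 0 2 - m 0 1 0 2 * m 0 2 0 1 = 0"
    have van: "x * m 0 1 k l + y * m 0 2 k l = 0"
      if "x * m 0 1 0 1 + y * m 0 2 0 1 = 0" "x * m 0 1 0 2 + y * m 0 2 0 2 = 0" for x y k l
    proof -
      define w where "w i j = x * m 0 1 i j + y * m 0 2 i j" for i j
      have w: "w i i = 0" "w i j = - w j i" for i j
        by (simp_all add: w_def z(1) z(2)[of _ i j])
      have w0: "w 0 1 = 0" "w 0 2 = 0" "w 0 3 = 0" "w 1 2 = 0" "w 1 3 = 0" "w 2 3 = 0"
        using that m0[of 1] m0[of 2] by (simp_all add: w_def)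
      have "\<forall>i j. w i j = 0"
        unfolding all_4_iff using w0
        by (simp add: w(1) w(2)[of 1 0] w(2)[of 2 0] w(2)[of 3 0] w(2)[of 2 1] w(2)[of 3 1] w(2)[of 3 2])
      then show ?thesis by (simp add: w_def)
    qed
    \<comment> \<open>If the determinant vanishes, these coefficients annihilate both coordinates,
      so \<open>ker\<close> forces them to be 0. The next step treats the other coordinate, and then
      the first bivector itself vanishes.\<close>
    have "m 0 2 0 1 = 0 \<and> m 0 1 0 1 = 0"
      using van[of "m 0 2 0 1" "- m 0 1 0 1"] ker[of "m 0 2 0 1" "- m 0 1 0 1"] det0
      by (force simp: algebra_simps)
    moreover have "m 0 2 0 2 = 0 \<and> m 0 1 0 2 = 0"
      using van[of "m 0 2 0 2" "- m 0 1 0 2"] ker[of "m 0 2 0 2" "- m 0 1 0 2"] det0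
      by (force simp: algebra_simps)
    ultimately show False using van[of 1 0] ker[of 1 0] by auto
  qed
  have col0: "M $ 1 $ 0 = 0" "M $ 2 $ 0 = 0" "M $ 3 $ 0 = 0"
  proof -
    \<comment> \<open>Column 0 wedges to zero with both bivectors; since these span
      \<open>s 0 1\<close> and \<open>s 0 2\<close>, column 0 is a multiple of the first basis
      vector. Below, the coordinates are isolated by multiplying with the determinant
      \<open>?d\<close>.\<close>
    have 1: "M $ 1 $ 0 * m 0 j 0 2 = M $ 2 $ 0 * m 0 j 0 1"
      and 2: "M $ 3 $ 0 * m 0 j 0 1 = 0" "M $ 3 $ 0 * m 0 j 0 2 = 0" if "j = 1 \<or> j = 2" for j
      using dep[of 0 j 1 2] dep[of 0 j 1 3] dep[of 0 j 2 3] m0[OF that] by simp_all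
    let ?d = "m 0 1 0 1 * m 0 2 0 2 - m 0 1 0 2 * m 0 2 0 1"
    have "M $ 1 $ 0 * ?d = m 0 1 0 1 * (M $ 1 $ 0 * m 0 2 0 2) - m 0 2 0 1 * (M $ 1 $ 0 * m 0 1 0 2)"
      by (simp add: algebra_simps)
    also have "\<dots> = 0"
      by (simp add: 1)
    finally show "M $ 1 $ 0 = 0" using nz by simp
    have "M $ 2 $ 0 * ?d = m 0 2 0 2 * (M $ 2 $ 0 * m 0 1 0 1) - m 0 1 0 2 * (M $ 2 $ 0 * m 0 2 0 1)"
      by (simp add: algebra_simps)
    also have "\<dots> = 0"
      by (simp add: 1[symmetric])
    finally show "M $ 2 $ 0 = 0" using nz by simp
    have "M $ 3 $ 0 * ?d = m 0 2 0 2 * (M $ 3 $ 0 * m 0 1 0 1) - m 0 2 0 1 * (M $ 3 $ 0 * m 0 1 0 2)"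
      by (simp add: algebra_simps)
    also have "\<dots> = 0"
      by (simp add: 2)
    finally show "M $ 3 $ 0 = 0" using nz by simp
  qed
  have a: "M $ 0 $ 0 \<noteq> 0"
    using nz col0 by (auto simp: m_def)
  have row3: "M $ 3 $ 1 = 0" "M $ 3 $ 2 = 0"
    using m0[of 1] m0[of 2] a col0 by (simp_all add: m_def)
  define D :: "'a ^ 2 ^ 2" where
    "D = vector [vector [M $ 1 $ 1, M $ 1 $ 2], vector [M $ 2 $ 1, M $ 2 $ 2]]"
  \<comment> \<open>The image of \<open>s 0 3 + s 1 2\<close> lies in \<open>U\<close>, so its
    entries (0,3) and (1,2) agree.\<close>
  have rel: "M $ 0 $ 0 * M $ 3 $ 3 = det D"
    using gen[of 0 0 1] unfolding U_iff nth by (simp add: m_def col0 row3 D_def det_2)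
  have detD: "det D \<noteq> 0"
  proof -
    have "M $ 0 $ 0 * M $ 0 $ 0 * det D = m 0 1 0 1 * m 0 2 0 2 - m 0 1 0 2 * m 0 2 0 1"
      by (simp add: m_def col0 D_def det_2 algebra_simps)
    with nz show ?thesis by auto
  qed
  have "M = block_mat (M $ 0 $ 0) (vector [M $ 0 $ 1, M $ 0 $ 2]) (M $ 0 $ 3) D
      (vector [M $ 1 $ 3, M $ 2 $ 3])"
    unfolding vec_eq_iff all_4_iff using rel[symmetric] a by (simp add: col0 row3 D_def)
  with that a detD show ?thesis by blast
qed

lemma carrier_GL_iff: "M \<in> carrier GL \<longleftrightarrow> invertible M"
  by (simp add: GL_def)

lemma stabilizer_U:
  "stabilizer (GL :: ('a::field ^ 4 ^ 4) monoid) set_act U =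
     {block_mat a b c D e | a b c D e. a \<noteq> 0 \<and> D \<in> carrier GL}" (is "?L = ?R")
proof (intro equalityI subsetI)
  fix M :: "'a ^ 4 ^ 4"
  assume "M \<in> ?L"
  then have "invertible M" "act M ` U \<subseteq> U"
    by (simp_all add: stabilizer_def carrier_GL_iff set_act_def)
  then obtain a b c D e where "a \<noteq> 0" "det D \<noteq> 0" "M = block_mat a b c D e"
    by (rule stabilizes_U_imp_block_mat)
  moreover from this have "D \<in> carrier GL"
    by (simp add: carrier_GL_iff invertible_det_nz)
  ultimately show "M \<in> ?R" by blast
next
  fix M :: "'a ^ 4 ^ 4"
  assume "M \<in> ?R"
  then obtain a b c D e where "a \<noteq> 0" "det D \<noteq> 0" and M: "M = block_mat a b c D e"
    by (auto simp: carrier_GL_iff invertible_det_nz)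
  then show "M \<in> ?L"
    unfolding M by (simp add: stabilizer_def carrier_GL_iff set_act_def act_block_mat_U invertible_block_mat)
qed

lemma carrier_GL_U:
  "carrier GL_U = {block_mat a b c D e | a b c D e. a \<noteq> 0 \<and> det D \<noteq> (0::'a::field)}"
  unfolding GL_U_def by (simp add: stabilizer_U carrier_GL_iff invertible_det_nz)

lemma block_mat_in_GL_U:
  "a \<noteq> 0 \<Longrightarrow> det D \<noteq> 0 \<Longrightarrow> block_mat a b c D e \<in> carrier GL_U"
  unfolding carrier_GL_U by blast

lemma GL_U_E:
  assumes "M \<in> carrier GL_U"
  obtains a b c D e where "a \<noteq> 0" "det D \<noteq> 0" "M = block_mat a b c D e"
  using assms unfolding carrier_GL_U by blast

section \<open>Separating orbits by a numerical invariant\<close>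

text \<open>All points of the orbit of \<open>x\<close> have invariant \<open>\<kappa> x\<close>,
  and the list entry at position i has invariant i. Hence an orbit determines the position of any
  list entry in it.\<close>

lemma represent_orbitsI:
  fixes \<kappa> :: "'x \<Rightarrow> nat"
  assumes "set xs \<subseteq> E"
    and reach: "\<And>x. x \<in> E \<Longrightarrow> \<exists>g \<in> carrier G. \<phi> g x \<in> set xs"
    and invariant: "\<And>g x. g \<in> carrier G \<Longrightarrow> x \<in> E \<Longrightarrow> \<kappa> (\<phi> g x) = \<kappa> x"
    and separate: "\<And>i. i < length xs \<Longrightarrow> \<kappa> (xs ! i) = i"
  shows "represent_orbits G E \<phi> xs"
  unfolding represent_orbits_def
proof (intro conjI ballI)
  fix Q
  assume "Q \<in> orbits G E \<phi>"
  then obtain x where x: "x \<in> E" and Q: "Q = {\<phi> g x | g. g \<in> carrier G}"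
    unfolding orbits_def orbit_def by blast
  obtain g where "g \<in> carrier G" "\<phi> g x \<in> set xs"
    using reach[OF x] by blast
  then obtain i where i: "i < length xs" "xs ! i \<in> Q"
    unfolding Q in_set_conv_nth by auto
  show "\<exists>!i. i < length xs \<and> xs ! i \<in> Q"
  proof (rule ex1I[of _ i])
    fix j
    assume j: "j < length xs \<and> xs ! j \<in> Q"
    have "\<kappa> y = \<kappa> x" if "y \<in> Q" for y
      using that x invariant unfolding Q by blast
    then show "j = i"
      using i j separate by metis
  qed (use i in simp)
qed (rule assms)

section \<open>Orbits on column vectors\<close>

lemma all_less_4_nat: "i < 4 \<Longrightarrow> i = 0 \<or> i = 1 \<or> i = 2 \<or> i = (3::nat)"
  by linarith

text \<open>Transitivity of the group of invertible 2 x 2 matrices on nonzero vectors. The case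
  split picks a nonzero coordinate as pivot.\<close>

lemma det_nonzero_mult_e1:
  fixes x y :: "'a::field"
  assumes "x \<noteq> 0 \<or> y \<noteq> 0"
  obtains D :: "'a ^ 2 ^ 2"
  where "det D \<noteq> 0" "D $ 1 $ 1 * x + D $ 1 $ 2 * y = 1" "D $ 2 $ 1 * x + D $ 2 $ 2 * y = 0"
proof (cases "x = 0")
  case True
  then show ?thesis
    using assms by (intro that[of "vector [vector [0, 1 / y], vector [1, 0]]"]) (simp_all add: det_2)
next
  case False
  then show ?thesis
    by (intro that[of "vector [vector [1 / x, 0], vector [- y / x, 1]]"]) (simp_all add: det_2)
qed

lemma linear_form_onto:
  fixes x y z :: "'a::field"
  assumes "x \<noteq> 0 \<or> y \<noteq> 0"
  obtains b :: "'a ^ 2" where "b $ 1 * x + b $ 2 * y = z"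
proof (cases "x = 0")
  case True
  then show ?thesis
    using assms by (intro that[of "vector [0, z / y]"]) simp
next
  case False
  then show ?thesis
    by (intro that[of "vector [z / x, 0]"]) simp
qed

lemma orbits_vec:
  "represent_orbits (GL_U :: ('a::field ^ 4 ^ 4) monoid) UNIV (\<lambda>M v. M *v v)
     [0, basis_vec 0, basis_vec 1, basis_vec 3]"
proof (rule represent_orbitsI)
  define \<kappa> :: "'a ^ 4 \<Rightarrow> nat" where
    \<comment> \<open>The least step of the invariant flag 0 < \<langle>b0\<rangle> < \<langle>b0,
      b1, b2\<rangle> < K^4 that contains \<open>v\<close>.\<close>
    "\<kappa> v = (if v $ 3 \<noteq> 0 then 3 else if v $ 1 \<noteq> 0 \<or> v $ 2 \<noteq> 0 then 2 else if v $ 0 \<noteq> 0 then 1 else 0)" for v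
  show "\<kappa> ([0, basis_vec 0, basis_vec 1, basis_vec 3] ! i) = i"
    if "i < length [0, basis_vec 0, basis_vec 1, basis_vec 3 :: 'a ^ 4]" for i
    using all_less_4_nat[of i] that by (auto simp: \<kappa>_def axis_def)
  show "\<kappa> (M *v v) = \<kappa> v" if M_in: "M \<in> carrier GL_U" for M v
  proof -
    obtain a b c D e where a: "a \<noteq> 0" and D: "det D \<noteq> 0" and M: "M = block_mat a b c D e"
      using M_in by (rule GL_U_E)
    let ?w = "vector [v $ 1, v $ 2] :: 'a ^ 2"
    have "D *v ?w = 0 \<longleftrightarrow> ?w = 0"
      using D invertible_det_nz[of D] by (metis invertible_iff_ker matrix_vector_mult_0_right)
    then have "D $ 1 $ 1 * v $ 1 + D $ 1 $ 2 * v $ 2 = 0 \<and> D $ 2 $ 1 * v $ 1 + D $ 2 $ 2 * v $ 2 = 0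
      \<longleftrightarrow> v $ 1 = 0 \<and> v $ 2 = 0"
      by (simp add: vec_eq_iff forall_2 matrix_vector_mult_def sum_2)
    then show ?thesis
      using a D unfolding \<kappa>_def M by (auto simp: matrix_vector_mult_nth_4)
  qed
  show "\<exists>M \<in> carrier GL_U. M *v v \<in> set [0, basis_vec 0, basis_vec 1, basis_vec 3]" for v :: "'a ^ 4"
  proof -
    consider "v $ 3 \<noteq> 0" | "v $ 3 = 0" "v $ 1 \<noteq> 0 \<or> v $ 2 \<noteq> 0"
      | "v $ 3 = 0" "v $ 1 = 0" "v $ 2 = 0" "v $ 0 \<noteq> 0" | "v = 0"
      unfolding vec_eq_iff all_4_iff by auto
    then show ?thesis
    proof cases
      case 1
      \<comment> \<open>With the identity as middle block the last diagonal entry is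
        \<open>1 / v $ 3\<close>, which normalizes coordinate 3 to 1; the last column clears the
        other coordinates.\<close>
      let ?M = "block_mat (v $ 3) 0 (- v $ 0) (mat 1) (vector [- v $ 1 / v $ 3, - v $ 2 / v $ 3])"
      have "?M *v v = basis_vec 3"
        unfolding vec_eq_iff all_4_iff using 1
        by (simp add: matrix_vector_mult_nth_4 mat_def axis_def det_2)
      moreover have "?M \<in> carrier GL_U"
        using 1 by (intro block_mat_in_GL_U) simp_all
      ultimately show ?thesis by auto
    next
      case 2
      obtain D :: "'a ^ 2 ^ 2" where D: "det D \<noteq> 0" "D $ 1 $ 1 * v $ 1 + D $ 1 $ 2 * v $ 2 = 1"
        "D $ 2 $ 1 * v $ 1 + D $ 2 $ 2 * v $ 2 = 0"
        using 2(2) by (rule det_nonzero_mult_e1)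
      obtain b :: "'a ^ 2" where b: "b $ 1 * v $ 1 + b $ 2 * v $ 2 = - v $ 0"
        using 2(2) by (rule linear_form_onto)
      have "block_mat 1 b 0 D 0 *v v = basis_vec 1"
        unfolding vec_eq_iff all_4_iff using 2 D b
        by (simp add: matrix_vector_mult_nth_4 axis_def add.assoc)
      moreover have "block_mat 1 b 0 D 0 \<in> carrier GL_U"
        using D by (intro block_mat_in_GL_U) simp_all
      ultimately show ?thesis by auto
    next
      case 3
      let ?M = "block_mat (1 / v $ 0) 0 0 (mat 1) 0"
      have "?M *v v = basis_vec 0"
        unfolding vec_eq_iff all_4_iff using 3
        by (simp add: matrix_vector_mult_nth_4 mat_def axis_def det_2)
      moreover have "?M \<in> carrier GL_U"
        using 3 by (intro block_mat_in_GL_U) simp_all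
      ultimately show ?thesis by auto
    next
      case 4
      have "block_mat 1 0 0 (mat 1) (0 :: 'a ^ 2) \<in> carrier GL_U"
        by (intro block_mat_in_GL_U) simp_all
      then show ?thesis using 4 by (intro bexI) auto
    qed
  qed
qed simp

section \<open>Orbits on the quotient of \<open>Lam\<close> by \<open>U\<close>\<close>

lemma Lam_diff: "X \<in> Lam \<Longrightarrow> Y \<in> Lam \<Longrightarrow> X - Y \<in> Lam"
  by (rule mat_vs.subspace_diff[OF subspace_Lam])

lemma coset_iff: "Y \<in> X +o U \<longleftrightarrow> Y - X \<in> U"
proof
  assume "Y - X \<in> U"
  then show "Y \<in> X +o U" by (metis diff_add_cancel add.commute set_plus_intro2)
qed (auto simp: elt_set_plus_def)

lemma coset_self: "X \<in> X +o U"
  unfolding coset_iff by (simp add: U_def mat_vs.span_zero)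

lemma coset_eq_iff: "X +o U = Y +o U \<longleftrightarrow> X - Y \<in> U"
proof
  assume "X +o U = Y +o U"
  moreover have "X \<in> X +o U"
    by (rule coset_self)
  ultimately show "X - Y \<in> U" by (simp add: coset_iff)
next
  assume *: "X - Y \<in> U"
  have "Z - X \<in> U \<longleftrightarrow> Z - Y \<in> U" for Z
    using mat_vs.span_add[of "Z - X" _ "X - Y"] mat_vs.span_diff[of "Z - Y" _ "X - Y"] *
    unfolding U_def by (auto simp: algebra_simps)
  then show "X +o U = Y +o U" by (auto simp: coset_iff)
qed

text \<open>On \<open>\<Lambda>/U\<close> the entries \<open>x\<^sub>1\<^sub>3\<close>, \<open>x\<^sub>2\<^sub>3\<close> and \<open>x\<^sub>0\<^sub>3 - x\<^sub>1\<^sub>2\<close> are coordinates.\<close>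

definition orbit_index :: "'a::field ^ 4 ^ 4 \<Rightarrow> nat" where
  "orbit_index X = (if X $ 1 $ 3 \<noteq> 0 \<or> X $ 2 $ 3 \<noteq> 0 then 2 else if X $ 0 $ 3 \<noteq> X $ 1 $ 2 then 1 else 0)"

lemma orbit_index_coset:
  "Y \<in> X +o U \<Longrightarrow> orbit_index Y = orbit_index X"
  by (auto simp: orbit_index_def coset_iff U_iff algebra_simps)

text \<open>The pair of entries (1,3), (2,3) is transformed by \<open>D\<close> times the scalar
  \<open>det D / a\<close>. Where this pair is zero, the third coordinate is multiplied by
  \<open>det D\<close>. So the flag formed by 0, the line of \<open>s 0 3 +o U\<close> and the whole
  quotient is invariant.\<close>

lemma orbit_index_act:
  assumes M: "M \<in> carrier GL_U" and X: "X \<in> Lam"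
  shows "orbit_index (act M X) = orbit_index X"
proof -
  obtain a b c D e where a: "a \<noteq> 0" and D: "det D \<noteq> 0" and M: "M = block_mat a b c D e"
    using M by (rule GL_U_E)
  let ?w = "vector [X $ 1 $ 3, X $ 2 $ 3] :: 'a ^ 2"
  have "D *v ?w = 0 \<longleftrightarrow> ?w = 0"
    using D invertible_det_nz[of D] by (metis invertible_iff_ker matrix_vector_mult_0_right)
  then have "D $ 1 $ 1 * X $ 1 $ 3 + D $ 1 $ 2 * X $ 2 $ 3 = 0 \<and> D $ 2 $ 1 * X $ 1 $ 3 + D $ 2 $ 2 * X $ 2 $ 3 = 0
    \<longleftrightarrow> X $ 1 $ 3 = 0 \<and> X $ 2 $ 3 = 0"
    by (simp add: vec_eq_iff forall_2 matrix_vector_mult_def sum_2)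
  moreover have "act M X $ 1 $ 3 = det D / a * (D $ 1 $ 1 * X $ 1 $ 3 + D $ 1 $ 2 * X $ 2 $ 3)"
    "act M X $ 2 $ 3 = det D / a * (D $ 2 $ 1 * X $ 1 $ 3 + D $ 2 $ 2 * X $ 2 $ 3)"
    by (simp_all add: act_nth[OF X] M distrib_left mult.commute mult.left_commute)
  ultimately have 1: "act M X $ 1 $ 3 = 0 \<and> act M X $ 2 $ 3 = 0 \<longleftrightarrow> X $ 1 $ 3 = 0 \<and> X $ 2 $ 3 = 0"
    using a D by simp
  have "act M X $ 0 $ 3 - act M X $ 1 $ 2 = det D * (X $ 0 $ 3 - X $ 1 $ 2)"
    if "X $ 1 $ 3 = 0" "X $ 2 $ 3 = 0"
    using a that by (simp add: act_nth[OF X] M) (simp add: det_2 algebra_simps)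
  then have 2: "act M X $ 0 $ 3 = act M X $ 1 $ 2 \<longleftrightarrow> X $ 0 $ 3 = X $ 1 $ 2"
    if "X $ 1 $ 3 = 0" "X $ 2 $ 3 = 0"
    using that D by (metis mult_eq_0_iff right_minus_eq)
  show ?thesis
    unfolding orbit_index_def using 1 2 by auto
qed

lemma orbits_Lam_mod_U:
  "represent_orbits (GL_U :: ('a::field ^ 4 ^ 4) monoid) Lam_mod_U set_act
     [U, s 0 3 +o U, s 1 3 +o U]"
proof (rule represent_orbitsI)
  \<comment> \<open>The choice of representative is harmless by
    \<open>orbit_index_coset\<close>.\<close>
  define \<kappa> :: "('a ^ 4 ^ 4) set \<Rightarrow> nat" where "\<kappa> C = orbit_index (SOME X. X \<in> C)" for C
  have U0: "(U :: ('a ^ 4 ^ 4) set) = 0 +o U"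
    by (auto simp: coset_iff)
  have \<kappa>: "\<kappa> (X +o U) = orbit_index X" for X
  proof -
    show ?thesis
      unfolding \<kappa>_def by (rule orbit_index_coset) (rule someI, rule coset_self)
  qed
  have Lam0: "(0 :: 'a ^ 4 ^ 4) \<in> Lam"
    by (rule mat_vs.subspace_0[OF subspace_Lam])
  show "set [U, s 0 3 +o U, s 1 3 +o U] \<subseteq> (Lam_mod_U :: ('a ^ 4 ^ 4) set set)"
  proof -
    have "X +o U \<in> Lam_mod_U" if "X \<in> Lam" for X :: "'a ^ 4 ^ 4"
      using that unfolding Lam_mod_U_def by blast
    from this[OF Lam0] this[OF s_in_Lam] show ?thesis
      by (simp add: U0[symmetric])
  qed
  show "\<kappa> ([U, s 0 3 +o U, s 1 3 +o U] ! i) = i"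
    if "i < length [U, s 0 3 +o U, s 1 3 +o U :: ('a ^ 4 ^ 4) set]" for i
  proof -
    have "\<kappa> U = orbit_index (0 :: 'a ^ 4 ^ 4)" using \<kappa>[of 0] U0 by simp
    then show ?thesis
      using that less_antisym[of i 2] less_antisym[of i 1]
      by (auto simp: \<kappa> orbit_index_def s_nth_iff less_Suc_eq)
  qed
  show "\<kappa> (set_act M C) = \<kappa> C" if "M \<in> carrier GL_U" "C \<in> Lam_mod_U" for M C
    using that unfolding Lam_mod_U_def by (auto simp: set_act_coset \<kappa> orbit_index_act)
  show "\<exists>M \<in> carrier GL_U. set_act M C \<in> set [U, s 0 3 +o U, s 1 3 +o U]"
    if C_in: "C \<in> Lam_mod_U" for C :: "('a ^ 4 ^ 4) set"
  proof -
    obtain X where X: "X \<in> Lam" and C: "C = X +o U"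
      using C_in unfolding Lam_mod_U_def by blast
    \<comment> \<open>It suffices to match the three coordinates on the quotient with those of a
      representative.\<close>
    have *: ?thesis if M: "M \<in> carrier GL_U" and Y: "Y \<in> {0, s 0 3, s 1 3}" and
      eq: "act M X $ 0 $ 3 - act M X $ 1 $ 2 = Y $ 0 $ 3 - Y $ 1 $ 2"
        "act M X $ 1 $ 3 = Y $ 1 $ 3" "act M X $ 2 $ 3 = Y $ 2 $ 3" for M Y
    proof -
      have "Y \<in> Lam"
        using Y Lam0 s_in_Lam by auto
      then have "act M X - Y \<in> U"
        using eq X by (auto simp: U_iff Lam_diff act_in_Lam algebra_simps)
      then have "set_act M C = Y +o U"
        using M unfolding C by (simp add: set_act_coset coset_eq_iff)
      moreover have "Y +o U \<in> {0 +o U, s 0 3 +o U, s 1 3 +o U}"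
        using Y by blast
      ultimately have "set_act M C \<in> set [U, s 0 3 +o U, s 1 3 +o U]"
        by (simp only: U0[symmetric] list.set)
      with M show ?thesis ..
    qed
    consider "X $ 1 $ 3 \<noteq> 0 \<or> X $ 2 $ 3 \<noteq> 0"
      | "X $ 1 $ 3 = 0" "X $ 2 $ 3 = 0" "X $ 0 $ 3 \<noteq> X $ 1 $ 2"
      | "X $ 1 $ 3 = 0" "X $ 2 $ 3 = 0" "X $ 0 $ 3 = X $ 1 $ 2"
      by blast
    then show ?thesis
    proof cases
      case 1
      obtain D :: "'a ^ 2 ^ 2" where D: "det D \<noteq> 0" "D $ 1 $ 1 * X $ 1 $ 3 + D $ 1 $ 2 * X $ 2 $ 3 = 1"
        "D $ 2 $ 1 * X $ 1 $ 3 + D $ 2 $ 2 * X $ 2 $ 3 = 0"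
        using 1 by (rule det_nonzero_mult_e1)
      obtain b :: "'a ^ 2" where
        b: "b $ 1 * X $ 1 $ 3 + b $ 2 * X $ 2 $ 3 = det D * (X $ 1 $ 2 - X $ 0 $ 3)"
        using 1 by (rule linear_form_onto)
      \<comment> \<open>Taking \<open>det D\<close> as first entry makes the last diagonal entry 1,
        so the entries (1,3), (2,3) become exactly (1, 0). The choice of \<open>b\<close> cancels
        the remaining coordinate.\<close>
      let ?M = "block_mat (det D) b 0 D 0"
      have "act ?M X $ 0 $ 3 = X $ 0 $ 3 * det D + (b $ 1 * X $ 1 $ 3 + b $ 2 * X $ 2 $ 3)"
        using D(1) by (simp add: act_nth[OF X] algebra_simps)
      also have "\<dots> = det D * X $ 1 $ 2"
        by (simp add: b algebra_simps)
      also have "\<dots> = act ?M X $ 1 $ 2"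
        by (simp add: act_nth[OF X]) (simp add: det_2)
      finally have 0: "act ?M X $ 0 $ 3 = act ?M X $ 1 $ 2" .
      have "act ?M X $ 1 $ 3 = 1" "act ?M X $ 2 $ 3 = 0"
        using D by (simp_all add: act_nth[OF X] mult.commute)
      with 0 show ?thesis
        using D(1) by (intro *[of ?M "s 1 3"] block_mat_in_GL_U) (simp_all add: s_nth_iff)
    next
      case 2
      define u where "u = X $ 0 $ 3 - X $ 1 $ 2"
      have u: "u \<noteq> 0" using 2 by (simp add: u_def)
      \<comment> \<open>The determinant \<open>1 / u\<close> scales the remaining coordinate
        \<open>u\<close> to 1.\<close>
      let ?D = "vector [vector [1 / u, 0], vector [0, 1]] :: 'a ^ 2 ^ 2"
      have D: "det ?D = 1 / u" by (simp add: det_2)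
      let ?M = "block_mat 1 0 0 ?D 0"
      have "act ?M X $ 0 $ 3 - act ?M X $ 1 $ 2 = (X $ 0 $ 3 - X $ 1 $ 2) / u"
        using 2 by (simp add: act_nth[OF X] D diff_divide_distrib)
      also have "\<dots> = 1"
        using u by (simp add: u_def)
      finally have "act ?M X $ 0 $ 3 - act ?M X $ 1 $ 2 = 1" .
      then show ?thesis
        using 2 u by (intro *[of ?M "s 0 3"] block_mat_in_GL_U)
          (simp_all add: s_nth_iff D, simp_all add: act_nth[OF X])
    next
      case 3
      let ?M = "block_mat 1 0 0 (mat 1) (0 :: 'a ^ 2)"
      show ?thesis
        using 3 by (intro *[of ?M 0] block_mat_in_GL_U) (simp_all add: act_nth[OF X] mat_def det_2)
    qed
  qed
qed

theorem proposition4p7: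
  shows "stabilizer (GL :: ('a::field ^ 4 ^ 4) monoid) set_act U =
           {block_mat a b c D e | a b c D e. a \<noteq> 0 \<and> D \<in> carrier GL}
         \<and> represent_orbits (GL_U :: ('a ^ 4 ^ 4) monoid) UNIV (\<lambda>M v. M *v v)
             [0, basis_vec 0, basis_vec 1, basis_vec 3]
         \<and> represent_orbits (GL_U :: ('a ^ 4 ^ 4) monoid) Lam_mod_U set_act
             [U, s 0 3 +o U, s 1 3 +o U]"
  by (intro conjI stabilizer_U orbits_vec orbits_Lam_mod_U)

end
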